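(* Let $m,n$ be positive integers and let $q,c\in\mathbb{C}$ with $q\neq 0$. If $n>m=1$, then the equation $$w'(z)^{n}+[w(qz+c)-w(z)]^{m}=1$$ has no transcendental entire solution of order zero.
   Context: The order of an entire function $w$ is $\rho(w)=\limsup_{r\to\infty}\frac{\log^{+}T(r,w)}{\log r}$, where $T(r,w)$ is the Nevanlinna characteristic function. "Order zero" means $\rho(w)=0$. An entire function is transcendental if it is not a polynomial. *)

theory Defs
  imports "HOL-Complex_Analysis.Complex_Analysis"
begin

definition log_plus :: "real \<Rightarrow> real" where
  "log_plus x = ln (max 1 x)"

definition proximity_fun :: "(complex \<Rightarrow> complex) \<Rightarrow> real \<Rightarrow> real" where
  "proximity_fun f r =
     1 / (2 * pi) * integral {0..2 * pi} (\<lambda>\<theta>. log_plus (norm (f (of_real r * cis \<theta>))))"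

(* Number of poles in the closed disc of radius t about 0, with multiplicity:
   at a pole of order k, zorder has the value -k. *)
definition pole_count :: "(complex \<Rightarrow> complex) \<Rightarrow> real \<Rightarrow> real" where
  "pole_count f t = (\<Sum>z\<in>{z. norm z \<le> t \<and> is_pole f z}. real_of_int (- zorder f z))"

definition counting_fun :: "(complex \<Rightarrow> complex) \<Rightarrow> real \<Rightarrow> real" where
  "counting_fun f r =
     integral {0..r} (\<lambda>t. (pole_count f t - pole_count f 0) / t) + pole_count f 0 * ln r"

(* For entire f there are no poles, so this is just the proximity function. *)
definition nevanlinna_char :: "(complex \<Rightarrow> complex) \<Rightarrow> real \<Rightarrow> real" where
  "nevanlinna_char f r = proximity_fun f r + counting_fun f r"

definition growth_order :: "(complex \<Rightarrow> complex) \<Rightarrow> ereal" where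
  "growth_order f = Limsup at_top (\<lambda>r::real. ereal (log_plus (nevanlinna_char f r) / ln r))"

definition entire :: "(complex \<Rightarrow> complex) \<Rightarrow> bool" where
  "entire f \<longleftrightarrow> f holomorphic_on UNIV"

definition transcendental_entire :: "(complex \<Rightarrow> complex) \<Rightarrow> bool" where
  "transcendental_entire f \<longleftrightarrow> entire f \<and> \<not> (\<exists>p. \<forall>z. f z = poly p z)"

end

theory Submission
  imports Defs
begin

text \<open>
  Put \<open>K = \<bar>q\<bar> + 2\<close>. Evaluating the equation at a point where \<open>w'\<close> is large on the disc of radius \<open>r\<close>
  bounds \<open>\<bar>w'\<bar>\<^sup>n\<close> there by a multiple of \<open>K r\<close> times the maximum of \<open>\<bar>w'\<bar>\<close> on the disc of radius \<open>K r\<close>.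
  As \<open>n \<ge> 2\<close>, the maximum modulus, normalised by a multiple of the radius, is at least squared
  whenever the radius is multiplied by \<open>K\<close>, so its logarithm grows at least like a positive power of
  the radius. By the Poisson-Jensen inequality this forces positive order.
\<close>

section \<open>Integrals over a period, Riemann sums and Jensen's inequality\<close>

lemma log_plus_nonneg: "log_plus x \<ge> 0"
  by (simp add: log_plus_def)

lemma continuous_on_log_plus [continuous_intros]:
  "continuous_on A f \<Longrightarrow> continuous_on A (\<lambda>x. log_plus (f x))"
  unfolding log_plus_def by (intro continuous_intros) auto

text \<open>The parts of the two windows that do not overlap are translates of each other by
  \<open>p\<close>. This lets circle integrals start at any angle.\<close>

lemma integral_periodic:
  fixes v :: "real \<Rightarrow> real"
  assumes v: "continuous_on UNIV v" and per: "\<And>x. v (x + p) = v x" and "p \<ge> 0"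
  shows "integral {a..a + p} v = integral {b..b + p} v"
proof -
  have int: "v integrable_on {x..y}" for x y
    by (intro integrable_continuous_real continuous_on_subset[OF v]) auto
  have *: "integral {a..a + p} v = integral {b..b + p} v" if "a \<le> b" for a b
  proof -
    have "(v has_integral integral {a + p..b + p} v) {a + p..b + p}"
      using int by (simp add: integrable_integral)
    from has_integral_affinity[of _ _ "a + p" "b + p" 1 p, simplified, OF this]
    have "integral {a + p..b + p} v = integral {a..b} v"
      by (simp add: per integral_unique)
    moreover have "integral {a..b} v + integral {b..b + p} v = integral {a..b + p} v"
      using that \<open>p \<ge> 0\<close> by (intro Henstock_Kurzweil_Integration.integral_combine int) auto
    moreover have "integral {a..a + p} v + integral {a + p..b + p} v = integral {a..b + p} v"
      using that \<open>p \<ge> 0\<close> by (intro Henstock_Kurzweil_Integration.integral_combine int) auto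
    ultimately show ?thesis by simp
  qed
  show ?thesis using *[of a b] *[of b a] by linarith
qed

text \<open>On each cell of length \<open>h\<close> the left-end value exceeds \<open>v\<close> by
  at most \<open>e\<close>, so a cell costs at most \<open>h * e\<close>. The oscillation bound will
  come from uniform continuity.\<close>

lemma riemann_sum_le_integral:
  fixes v :: "real \<Rightarrow> real"
  assumes v: "continuous_on {a..a + real n * h} v" and "h \<ge> 0"
    and le: "\<And>x y. \<lbrakk>x \<in> {a..a + real n * h}; y \<in> {a..a + real n * h}; \<bar>x - y\<bar> \<le> h\<rbrakk> \<Longrightarrow> v x \<le> v y + e"
  shows "h * (\<Sum>k<n. v (a + real k * h)) \<le> integral {a..a + real n * h} v + real n * h * e"
  using v le
proof (induction n)
  case 0
  then show ?case by simp
next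
  case (Suc n)
  let ?b = "a + real n * h" and ?c = "a + real (Suc n) * h"
  have bc: "a \<le> ?b" "?b \<le> ?c" "?c - ?b = h"
    using \<open>h \<ge> 0\<close> by (auto simp: algebra_simps)
  have IH: "h * (\<Sum>k<n. v (a + real k * h)) \<le> integral {a..?b} v + real n * h * e"
  proof (rule Suc.IH)
    show "continuous_on {a..?b} v"
      by (rule continuous_on_subset[OF Suc.prems(1)]) (use bc in auto)
  next
    fix x y assume "x \<in> {a..?b}" "y \<in> {a..?b}" "\<bar>x - y\<bar> \<le> h"
    then show "v x \<le> v y + e" using bc by (intro Suc.prems(2)) auto
  qed
  have "integral {?b..?c} (\<lambda>x. v ?b - e) \<le> integral {?b..?c} v"
  proof (rule integral_le)
    show "v integrable_on {?b..?c}"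
      by (intro integrable_continuous_real continuous_on_subset[OF Suc.prems(1)]) (use bc in auto)
    fix x assume "x \<in> {?b..?c}"
    then have "v ?b \<le> v x + e"
      using bc by (intro Suc.prems(2)) (unfold atLeastAtMost_iff abs_le_iff, linarith+)
    then show "v ?b - e \<le> v x" by simp
  qed auto
  then have "h * (v ?b - e) \<le> integral {?b..?c} v" using bc by (simp add: algebra_simps)
  moreover have "integral {a..?b} v + integral {?b..?c} v = integral {a..?c} v"
    using bc by (intro Henstock_Kurzweil_Integration.integral_combine integrable_continuous_real Suc.prems(1)) auto
  ultimately show ?case using IH by (simp add: algebra_simps)
qed

text \<open>The product of the rotations of \<open>F\<close> by all \<open>n\<close>-th roots of unity has value \<open>F(0)\<^sup>n\<close> at the
  centre, and on the circle the logarithm of its modulus is a Riemann sum of the integral, so the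
  maximum principle replaces the treatment of the zeros in Jensen's formula.\<close>

lemma ln_norm_center_le:
  assumes cont: "continuous_on (cball 0 1) F" and hol: "F holomorphic_on ball 0 1" and "F 0 \<noteq> 0"
  shows "2 * pi * ln (norm (F 0)) \<le> integral {0..2 * pi} (\<lambda>t. log_plus (norm (F (cis t))))"
proof (rule field_le_epsilon)
  fix e' :: real assume "e' > 0"
  \<comment> \<open>The Riemann sum error over a full turn is \<open>2 * pi * e\<close>, which is
    then exactly \<open>e'\<close>.\<close>
  define e where "e = e' / (2 * pi)"
  have "e > 0" using \<open>e' > 0\<close> by (simp add: e_def)
  \<comment> \<open>Truncation by \<open>log_plus\<close> keeps \<open>v\<close> continuous even
    where \<open>F\<close> vanishes on the circle.\<close>
  define v where "v t = log_plus (norm (F (cis t)))" for t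
  have v: "continuous_on S v" for S
    unfolding v_def by (intro continuous_intros continuous_on_compose2[OF cont]) auto
  have per: "v (x + 2 * pi) = v x" for x
    by (simp add: v_def flip: cis_mult)
  \<comment> \<open>A full turn starting at an angle in (-pi, pi] stays inside this interval, so one
    \<open>d\<close> serves every boundary point \<open>z\<close>.\<close>
  have "uniformly_continuous_on {-pi..4 * pi} v"
    by (intro compact_uniformly_continuous v) auto
  then obtain d where "d > 0"
    and d: "\<And>x y. \<lbrakk>x \<in> {-pi..4 * pi}; y \<in> {-pi..4 * pi}; dist y x < d\<rbrakk> \<Longrightarrow> dist (v y) (v x) < e"
    using \<open>e > 0\<close> unfolding uniformly_continuous_on_def by metis
  obtain n :: nat where n: "n > 0" "2 * pi / d < n"
    using reals_Archimedean2[of "2 * pi / d"] \<open>d > 0\<close>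
    by (metis divide_nonneg_pos leD less_eq_real_def not_gr_zero of_nat_0 pi_ge_zero zero_le_mult_iff zero_le_numeral)
  define h where "h = 2 * pi / n"
  have h: "h \<ge> 0" "h < d" "real n * h = 2 * pi"
    using n \<open>d > 0\<close> by (auto simp: h_def field_simps)
  define I where "I = integral {0..2 * pi} v"
  define P where "P z = (\<Prod>k<n. F (z * cis (real k * h)))" for z
  have bnd: "norm (P z) \<le> exp ((I + 2 * pi * e) / h)" if "z \<in> sphere 0 1" for z
  proof -
    define a where "a = Arg z"
    have z: "z = cis a" using that cis_Arg[of z] unfolding a_def by (force simp: sgn_div_norm)
    have a: "-pi < a" "a \<le> pi" unfolding a_def by (auto simp: Arg_bounded)
    have "h * (\<Sum>k<n. v (a + real k * h)) \<le> integral {a..a + real n * h} v + real n * h * e"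
    proof (rule riemann_sum_le_integral[OF v \<open>h \<ge> 0\<close>])
      fix x y assume "x \<in> {a..a + real n * h}" "y \<in> {a..a + real n * h}" "\<bar>x - y\<bar> \<le> h"
      then have "dist (v y) (v x) < e"
        using a h by (intro d) (auto simp: dist_real_def)
      then show "v x \<le> v y + e" by (simp add: dist_real_def)
    qed
    also have "\<dots> = I + 2 * pi * e"
      unfolding I_def h(3) using integral_periodic[OF v per, of a 0] by simp
    finally have S: "(\<Sum>k<n. v (a + real k * h)) \<le> (I + 2 * pi * e) / h"
      using n by (simp add: h_def field_simps)
    have "norm (P z) = (\<Prod>k<n. norm (F (cis (a + real k * h))))"
      by (simp add: P_def z cis_mult flip: prod_norm)
    \<comment> \<open>A factor of modulus below 1, possibly 0, is replaced by 1, so no logarithm of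
      zero occurs.\<close>
    also have "\<dots> \<le> (\<Prod>k<n. exp (v (a + real k * h)))"
      by (intro prod_mono) (auto simp: v_def log_plus_def)
    also have "\<dots> = exp (\<Sum>k<n. v (a + real k * h))" by (simp add: exp_sum)
    also have "\<dots> \<le> exp ((I + 2 * pi * e) / h)" using S by simp
    finally show ?thesis .
  qed
  have "norm (P 0) \<le> exp ((I + 2 * pi * e) / h)"
  proof (rule maximum_modulus_frontier[of P "cball 0 1"])
    show "P holomorphic_on interior (cball 0 1)"
      unfolding P_def
      by (auto intro!: holomorphic_intros holomorphic_on_compose_gen[OF _ hol, unfolded o_def] simp: norm_mult)
    show "continuous_on (closure (cball 0 1)) P"
      unfolding P_def by (auto intro!: continuous_intros continuous_on_compose2[OF cont] simp: norm_mult)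
  qed (use bnd in auto)
  then have "norm (F 0) ^ n \<le> exp ((I + 2 * pi * e) / h)" by (simp add: P_def norm_power)
  then have "ln (norm (F 0) ^ n) \<le> (I + 2 * pi * e) / h"
    using \<open>F 0 \<noteq> 0\<close> by (metis exp_gt_zero ln_exp ln_mono norm_eq_zero zero_less_norm_iff zero_less_power)
  then have "n * ln (norm (F 0)) \<le> (I + 2 * pi * e) / h" using \<open>F 0 \<noteq> 0\<close> by (simp add: ln_realpow)
  then have "n * (2 * pi * ln (norm (F 0))) \<le> n * (I + 2 * pi * e)"
    using n by (simp add: h_def field_simps)
  then have "2 * pi * ln (norm (F 0)) \<le> I + 2 * pi * e" using n by simp
  then show "2 * pi * ln (norm (F 0)) \<le> integral {0..2 * pi} (\<lambda>t. log_plus (norm (F (cis t)))) + e'"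
    by (simp add: e_def I_def v_def[abs_def])
qed


section \<open>Poisson-Jensen inequality away from the centre\<close>

text \<open>A disc automorphism moves \<open>a\<close> to the centre, where
  \<open>ln_norm_center_le\<close> applies. Returning to the original angle costs at most the
  maximum of the Poisson kernel, which is the quotient in front.\<close>

lemma ln_norm_le_proximity_fun:
  assumes cont: "continuous_on (cball 0 r) f" and hol: "f holomorphic_on ball 0 r"
    and a: "norm a < r" and "f a \<noteq> 0"
  shows "ln (norm (f a)) \<le> (r + norm a) / (r - norm a) * proximity_fun f r"
proof -
  have r: "r > 0" using a norm_ge_zero[of a] by linarith
  define b where "b = a / of_real r"
  define \<beta> where "\<beta> = norm b"
  have b: "\<beta> = norm a / r" "0 \<le> \<beta>" "\<beta> < 1"
    using a r by (auto simp: \<beta>_def b_def norm_divide)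
  \<comment> \<open>The real part is positive, so \<open>Ln\<close> stays on its principal branch
    and \<open>t\<close> is smooth.\<close>
  have den: "1 + cnj b * z \<notin> \<real>\<^sub>\<le>\<^sub>0" "1 + cnj b * z \<noteq> 0" if "norm z \<le> 1" for z
  proof -
    have "norm (cnj b * z) \<le> \<beta>"
      using that b(2) by (simp add: norm_mult \<beta>_def mult_left_le)
    then have "\<bar>Re (cnj b * z)\<bar> < 1" using abs_Re_le_cmod[of "cnj b * z"] b(3) by linarith
    then have "Re (1 + cnj b * z) > 0" by simp
    then show "1 + cnj b * z \<notin> \<real>\<^sub>\<le>\<^sub>0" "1 + cnj b * z \<noteq> 0"
      by (auto simp: complex_nonpos_Reals_iff simp del: plus_complex.sel times_complex.sel)
  qed
  \<comment> \<open>\<open>\<phi>\<close> is the automorphism of the disc taking \<open>0\<close> to \<open>b\<close>, and \<open>t\<close> is its lift to angles on the circle.\<close>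
  define \<phi> where "\<phi> z = (z + b) / (1 + cnj b * z)" for z
  define t where "t x = x - 2 * Im (Ln (1 + cnj b * cis x))" for x
  define t' where "t' x = 1 - 2 * Im (\<i> * (cnj b * cis x) / (1 + cnj b * cis x))" for x
  \<comment> \<open>On the circle the numerator equals \<open>cis x * cnj W\<close>, and
    \<open>cnj W / W\<close> has modulus 1 and angle \<open>- 2 * Im (Ln W)\<close>, which is the
    correction in \<open>t\<close>.\<close>
  have \<phi>_cis: "\<phi> (cis x) = cis (t x)" for x
  proof -
    define W where "W = 1 + cnj b * cis x"
    have W: "W \<noteq> 0" using den[of "cis x"] by (simp add: W_def)
    have "cis x * cnj W = cis x + b * (cis x * cnj (cis x))" by (simp add: W_def algebra_simps)
    also have "\<dots> = cis x + b" by (simp add: cis_cnj cis_mult)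
    finally have num: "cis x * cnj W = cis x + b" .
    have "cis (t x) = exp (\<i> * of_real x + (cnj (Ln W) - Ln W))"
      by (simp add: cis_conv_exp t_def W_def complex_eq_iff algebra_simps Re_exp Im_exp)
    also have "\<dots> = cis x * (cnj W / W)"
      using W by (simp add: exp_add exp_diff cis_conv_exp flip: exp_cnj)
    finally show ?thesis using num W by (simp add: \<phi>_def W_def)
  qed
  have \<phi>_ball: "norm (\<phi> z) < 1" if "norm z < 1" for z
    using Moebius_function_norm_lt_1[of "-b" z 0] that b by (simp add: \<phi>_def \<beta>_def Moebius_function_simple)
  have \<phi>_cball: "norm (\<phi> z) \<le> 1" if "norm z \<le> 1" for z
  proof (cases "norm z < 1")
    case False
    then have "z = cis (Arg z)" using that cis_Arg[of z] by (force simp: sgn_div_norm)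
    then show ?thesis using \<phi>_cis[of "Arg z"] by simp
  qed (use \<phi>_ball[of z] in simp)
  define u where "u s = log_plus (norm (f (of_real r * cis s)))" for s
  have u: "continuous_on S u" for S
    unfolding u_def using r
    by (intro continuous_intros continuous_on_compose2[OF cont]) (auto simp: norm_mult)
  have per: "u (x + 2 * pi) = u x" for x by (simp add: u_def flip: cis_mult)
  have u_nonneg: "u x \<ge> 0" for x by (simp add: u_def log_plus_nonneg)
  have t_deriv: "(t has_field_derivative t' x) (at x within S)" for x S
  proof -
    have "((\<lambda>x. 1 + cnj b * cis x) has_vector_derivative cnj b * (\<i> * cis x)) (at x within S)"
      by (auto intro!: derivative_eq_intros simp: has_vector_derivative_def scaleR_conv_of_real)
    from field_vector_diff_chain_within[OF this has_field_derivative_at_within[OF has_field_derivative_Ln]]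
    have "((\<lambda>x. Ln (1 + cnj b * cis x)) has_vector_derivative
        (\<i> * (cnj b * cis x) / (1 + cnj b * cis x))) (at x within S)"
      using den[of "cis x"] by (simp add: o_def field_simps)
    then show ?thesis
      unfolding t_def t'_def by (intro DERIV_diff DERIV_ident DERIV_cmult has_field_derivative_Im)
  qed
  \<comment> \<open>\<open>t' x\<close> is the real part of (1 - y) / (1 + y), a Poisson kernel; its
    numerator is fixed, and its denominator is bounded by |1 + y| \<le> 1 + \<beta>.\<close>
  have t'_ge: "(1 - \<beta>) / (1 + \<beta>) \<le> t' x" for x
  proof -
    define y where "y = cnj b * cis x"
    have ny: "norm y = \<beta>" by (simp add: y_def norm_mult \<beta>_def)
    have y: "1 + y \<noteq> 0" using den[of "cis x"] by (simp add: y_def)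
    have "t' x = Re (1 - 2 * (y / (1 + y)))"
      using Im_i_times[of "y / (1 + y)"] unfolding t'_def y_def[symmetric]
      by (simp del: times_divide_eq_right add: times_divide_eq_right[symmetric] del: Im_i_times)
    also have "1 - 2 * (y / (1 + y)) = (1 - y) / (1 + y)"
      using y by (simp add: field_simps)
    also have "Re \<dots> = (1 - (norm y)\<^sup>2) / (norm (1 + y))\<^sup>2"
      unfolding cmod_power2 Re_divide by (simp add: algebra_simps power2_eq_square)
    also have "\<dots> \<ge> (1 - \<beta>\<^sup>2) / (1 + \<beta>)\<^sup>2"
      unfolding ny using b y norm_triangle_ineq[of 1 y] ny
      by (intro divide_left_mono power_mono mult_pos_pos) (auto simp: abs_square_le_1 power_le_one)
    also have "(1 - \<beta>\<^sup>2) / (1 + \<beta>)\<^sup>2 = (1 - \<beta>) / (1 + \<beta>)"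
    proof -
      have "1 - \<beta>\<^sup>2 = (1 - \<beta>) * (1 + \<beta>)" by (simp add: power2_eq_square algebra_simps)
      moreover have "1 + \<beta> \<noteq> 0" using b(2) by linarith
      ultimately show ?thesis by (simp add: power2_eq_square)
    qed
    finally show ?thesis .
  qed
  have t'_nonneg: "t' x \<ge> 0" for x
    using t'_ge[of x] b divide_nonneg_nonneg[of "1 - \<beta>" "1 + \<beta>"] by linarith
  have t_cont: "continuous_on S t" for S
    using t_deriv DERIV_continuous_on by blast
  have t_mono: "t x \<le> t y" if "x \<le> y" for x y
    using that t_deriv[of _ UNIV] t'_nonneg by (meson DERIV_nonneg_imp_nondecreasing)
  \<comment> \<open>The logarithmic correction has period \<open>2 * pi\<close>, so \<open>t\<close>
    sweeps exactly one turn.\<close>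
  have t_2pi: "t (2 * pi) = t 0 + 2 * pi" by (simp add: t_def)
  have sub: "((\<lambda>x. t' x *\<^sub>R u (t x)) has_integral integral {t 0..t (2 * pi)} u) {0..2 * pi}"
    by (rule has_integral_substitution[where c = "t 0" and d = "t (2 * pi)"])
       (use t_deriv u t_mono in auto)
  have int: "(\<lambda>x. u (t x)) integrable_on {0..2 * pi}"
    by (intro integrable_continuous_real continuous_on_compose2[OF u[of UNIV]] t_cont) auto
  have "2 * pi * ln (norm (f a)) \<le> integral {0..2 * pi} (\<lambda>x. u (t x))"
  proof -
    have "2 * pi * ln (norm (f (of_real r * \<phi> 0)))
        \<le> integral {0..2 * pi} (\<lambda>x. log_plus (norm (f (of_real r * \<phi> (cis x)))))"
    proof (rule ln_norm_center_le)
      show "continuous_on (cball 0 1) (\<lambda>z. f (of_real r * \<phi> z))"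
      proof (intro continuous_on_compose2[OF cont] continuous_intros)
        show "continuous_on (cball 0 1) \<phi>"
          unfolding \<phi>_def by (intro continuous_intros) (use den in auto)
      qed (use r \<phi>_cball in \<open>auto simp: norm_mult\<close>)
      show "(\<lambda>z. f (of_real r * \<phi> z)) holomorphic_on ball 0 1"
      proof (intro holomorphic_on_compose_gen[OF _ hol, unfolded o_def] holomorphic_intros)
        show "\<phi> holomorphic_on ball 0 1"
          unfolding \<phi>_def by (intro holomorphic_intros) (use den in auto)
      qed (use r \<phi>_ball in \<open>auto simp: norm_mult\<close>)
    qed (use \<open>f a \<noteq> 0\<close> r in \<open>simp add: \<phi>_def b_def\<close>)
    then show ?thesis using r by (simp add: \<phi>_cis u_def) (simp add: \<phi>_def b_def)
  qed
  \<comment> \<open>The inserted weight is at least 1 by \<open>t'_ge\<close>, and it supplies the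
    factor \<open>t'\<close> needed for the substitution \<open>sub\<close>.\<close>
  also have "\<dots> \<le> integral {0..2 * pi} (\<lambda>x. (1 + \<beta>) / (1 - \<beta>) * (t' x *\<^sub>R u (t x)))"
  proof (rule integral_le[OF int])
    show "(\<lambda>x. (1 + \<beta>) / (1 - \<beta>) * (t' x *\<^sub>R u (t x))) integrable_on {0..2 * pi}"
      using sub by (intro integrable_on_mult_right) auto
    fix x
    have "1 \<le> (1 + \<beta>) / (1 - \<beta>) * t' x"
      using t'_ge[of x] b by (simp add: field_simps)
    from mult_right_mono[OF this u_nonneg[of "t x"]]
    show "u (t x) \<le> (1 + \<beta>) / (1 - \<beta>) * (t' x *\<^sub>R u (t x))" by (simp add: mult.assoc)
  qed
  also have "\<dots> = (1 + \<beta>) / (1 - \<beta>) * integral {t 0..t 0 + 2 * pi} u"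
    using sub unfolding t_2pi by (subst integral_mult_right) (simp add: integral_unique)
  also have "integral {t 0..t 0 + 2 * pi} u = integral {0..2 * pi} u"
    using integral_periodic[OF u per, of "t 0" 0] by simp
  also have "integral {0..2 * pi} u = 2 * pi * proximity_fun f r"
    by (simp add: proximity_fun_def u_def[abs_def])
  also have "(1 + \<beta>) / (1 - \<beta>) = (r + norm a) / (r - norm a)"
    using r a by (simp add: b(1) field_simps)
  finally have "2 * pi * ln (norm (f a)) \<le> 2 * pi * ((r + norm a) / (r - norm a) * proximity_fun f r)"
    by (simp only: mult_ac)
  then show ?thesis by (subst (asm) mult_le_cancel_left_pos) auto
qed

section \<open>Characteristic and order of entire functions\<close>

lemma proximity_fun_nonneg: "proximity_fun f r \<ge> 0"
proof -
  have "integral {0..2 * pi} (\<lambda>t. log_plus (norm (f (of_real r * cis t)))) \<ge> 0"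
    \<comment> \<open>For a non-integrable function \<open>integral\<close> takes its default value
      0, so nothing need be assumed on \<open>f\<close>.\<close>
    by (cases "(\<lambda>t. log_plus (norm (f (of_real r * cis t)))) integrable_on {0..2 * pi}")
       (auto intro: Henstock_Kurzweil_Integration.integral_nonneg simp: log_plus_nonneg not_integrable_integral)
  then show ?thesis by (simp add: proximity_fun_def)
qed

lemma nevanlinna_char_entire:
  assumes "entire f"
  shows "nevanlinna_char f r = proximity_fun f r"
proof -
  have "\<not> is_pole f z" for z
    using assms not_is_pole_holomorphic[of UNIV z f] by (simp add: entire_def)
  then have "pole_count f t = 0" for t by (simp add: pole_count_def)
  then show ?thesis by (simp add: nevanlinna_char_def counting_fun_def)
qed

text \<open>On the circle of radius \<open>2 * R\<close> the Poisson-Jensen factor is at most (2R +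
  R) / (2R - R) = 3.\<close>

lemma ln_norm_le_nevanlinna_char:
  assumes "entire f" "norm a \<le> R" "R > 0" "f a \<noteq> 0"
  shows "ln (norm (f a)) \<le> 3 * nevanlinna_char f (2 * R)"
proof -
  have hol: "f holomorphic_on UNIV" using assms(1) by (simp add: entire_def)
  have "ln (norm (f a)) \<le> (2 * R + norm a) / (2 * R - norm a) * proximity_fun f (2 * R)"
    using assms hol
    by (intro ln_norm_le_proximity_fun)
       (auto intro: holomorphic_on_subset holomorphic_on_imp_continuous_on continuous_on_subset)
  also have "\<dots> \<le> 3 * proximity_fun f (2 * R)"
    using assms by (intro mult_right_mono proximity_fun_nonneg) (simp add: field_simps)
  finally show ?thesis by (simp add: nevanlinna_char_entire[OF assms(1)])
qed

lemma growth_order_less_imp_powr_bound: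
  assumes "growth_order f < ereal e"
  shows "\<forall>\<^sub>F r in at_top. nevanlinna_char f r \<le> r powr e"
  \<comment> \<open>For \<open>r > 1\<close> the denominator \<open>ln r\<close> is positive and can
    be cleared.\<close>
  using Limsup_lessD[OF assms[unfolded growth_order_def]] eventually_gt_at_top[of 1]
proof eventually_elim
  case (elim r)
  then have "ln (max 1 (nevanlinna_char f r)) < e * ln r"
    by (simp add: log_plus_def field_simps)
  then have "max 1 (nevanlinna_char f r) < exp (e * ln r)"
    by (metis exp_less_cancel_iff exp_ln less_max_iff_disj zero_less_one)
  then show ?case using elim by (simp add: powr_def)
qed

text \<open>At radius comparable to \<open>K ^ j\<close> the characteristic is at least a multiple
  of \<open>2 ^ j\<close>, hence of a fixed positive power of the radius. Order zero would keep it
  below every positive power.\<close>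

lemma growth_order_nonzero_if_doubly_exponential:
  assumes f: "entire f" and "K > 1" "R > 0"
    and grow: "\<And>j::nat. \<exists>x. norm x \<le> R * K ^ j \<and> exp (2 ^ j) \<le> norm (f x)"
  shows "growth_order f \<noteq> 0"
proof
  assume ord: "growth_order f = 0"
  \<comment> \<open>The exponent makes \<open>K powr e = 3 / 2\<close>; any value strictly between 1
    and 2 would give the contradiction.\<close>
  define e where "e = ln (3 / 2) / ln K"
  have "e > 0" using \<open>K > 1\<close> by (simp add: e_def)
  have K_e: "K powr e = 3 / 2" using \<open>K > 1\<close> by (simp add: e_def powr_def)
  define C where "C = 3 * (2 * R) powr e"
  have pow: "filterlim (\<lambda>j. x ^ j) at_top sequentially" if "x > 1" for x :: real
    using that
    by (intro filterlim_at_infinity_imp_filterlim_at_top filterlim_realpow_sequentially_gt1) auto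
  have lim: "filterlim (\<lambda>j. 2 * (R * K ^ j)) at_top sequentially"
    using \<open>R > 0\<close>
    by (intro filterlim_tendsto_pos_mult_at_top[OF tendsto_const] pow[OF \<open>K > 1\<close>]) auto
  have "\<forall>\<^sub>F r in at_top. nevanlinna_char f r \<le> r powr e"
    using ord \<open>e > 0\<close> by (intro growth_order_less_imp_powr_bound) (simp add: zero_ereal_def)
  from eventually_compose_filterlim[OF this lim] have "\<forall>\<^sub>F j in sequentially. nevanlinna_char f (2 * (R * K ^ j)) \<le> (2 * (R * K ^ j)) powr e" .
  then have "\<forall>\<^sub>F j in sequentially. (4 / 3) ^ j \<le> C"
  proof eventually_elim
    case (elim j)
    obtain x where x: "norm x \<le> R * K ^ j" "exp (2 ^ j) \<le> norm (f x)" using grow by blast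
    then have fx: "norm (f x) > 0" using exp_gt_zero[of "2 ^ j :: real"] by linarith
    then have "2 ^ j \<le> ln (norm (f x))" using x(2) by (simp add: ln_ge_iff)
    also have "\<dots> \<le> 3 * nevanlinna_char f (2 * (R * K ^ j))"
      using f x fx assms by (intro ln_norm_le_nevanlinna_char) auto
    also have "\<dots> \<le> 3 * (2 * (R * K ^ j)) powr e" using elim by simp
    also have "(2 * (R * K ^ j)) powr e = (2 * R) powr e * (K powr e) ^ j"
    proof -
      have "(K ^ j) powr e = (K powr e) ^ j"
        using \<open>K > 1\<close> by (induction j) (auto simp: powr_mult)
      then show ?thesis using assms powr_mult[of "2 * R" "K ^ j" e] by (simp add: mult.assoc)
    qed
    finally have "2 ^ j \<le> C * (3 / 2) ^ j" by (simp add: K_e C_def)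
    \<comment> \<open>The quotient is \<open>(4 / 3) ^ j\<close>, which is unbounded.\<close>
    then have "2 ^ j / (3 / 2) ^ j \<le> C" by (simp add: divide_le_eq)
    then show ?case by (simp flip: power_divide)
  qed
  moreover have "\<forall>\<^sub>F j in sequentially. (4 / 3) ^ j > C"
    using pow[of "4 / 3"] by (simp add: filterlim_at_top_dense)
  ultimately have "\<forall>\<^sub>F j::nat in sequentially. False" by eventually_elim simp
  then show False by simp
qed

section \<open>Growth of the derivative forced by the equation\<close>

text \<open>Compactness gives the maximum point, and the mean value inequality along radii then
  controls \<open>w\<close> by \<open>w 0\<close> and this maximum.\<close>

lemma obtain_max_deriv:
  assumes hol: "w holomorphic_on UNIV" and "R \<ge> 0"
  obtains \<zeta> where "norm \<zeta> \<le> R"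
    "\<And>x. norm x \<le> R \<Longrightarrow> norm (deriv w x) \<le> norm (deriv w \<zeta>)"
    "\<And>x. norm x \<le> R \<Longrightarrow> norm (w x) \<le> norm (w 0) + R * norm (deriv w \<zeta>)"
proof -
  have "deriv w holomorphic_on UNIV" using hol by (simp add: holomorphic_deriv)
  then have "continuous_on (cball 0 R) (\<lambda>x. norm (deriv w x))"
    by (intro continuous_intros holomorphic_on_imp_continuous_on) (auto intro: holomorphic_on_subset)
  then obtain \<zeta> where \<zeta>: "norm \<zeta> \<le> R" "\<And>x. norm x \<le> R \<Longrightarrow> norm (deriv w x) \<le> norm (deriv w \<zeta>)"
    using continuous_attains_sup[of "cball 0 R" "\<lambda>x. norm (deriv w x)"] \<open>R \<ge> 0\<close> by auto
  moreover have "norm (w x) \<le> norm (w 0) + R * norm (deriv w \<zeta>)" if x: "norm x \<le> R" for x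
  proof -
    have "norm (w x - w 0) \<le> norm (deriv w \<zeta>) * norm (x - 0)"
    proof (rule field_differentiable_bound[of "cball 0 R"])
      show "(w has_field_derivative deriv w z) (at z within cball 0 R)" for z
        using holomorphic_derivI[OF hol] by (auto intro: has_field_derivative_at_within)
    qed (use \<zeta> x \<open>R \<ge> 0\<close> in auto)
    also have "\<dots> \<le> norm (deriv w \<zeta>) * R" using x by (intro mult_left_mono) auto
    finally show ?thesis using norm_triangle_ineq2[of "w x" "w 0"] by (simp add: mult.commute)
  qed
  ultimately show ?thesis using that by blast
qed

text \<open>The equation bounds the power of \<open>w'(z)\<close> by values of \<open>w\<close> in
  the disc of radius \<open>K * r\<close>, hence by \<open>K * r\<close> times the maximum of |w'|
  there; so the square of a lower bound passes to the larger disc. The second conclusion transfers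
  the size from \<open>w'\<close> to \<open>w\<close>.\<close>

lemma deriv_growth_step:
  assumes w: "w holomorphic_on UNIV"
    and eq: "\<And>z. deriv w z ^ n + (w (q * z + c) - w z) = 1"
    and n: "n \<ge> 2" and K: "K = norm q + 2"
    and r: "r \<ge> 1" "r \<ge> norm c" "r \<ge> 1 + 2 * norm (w 0)"
    and z: "norm z \<le> r" and E: "E \<ge> 1" "3 * K\<^sup>2 * r * E \<le> norm (deriv w z)"
  shows "\<exists>\<zeta>. norm \<zeta> \<le> K * r \<and> 3 * K\<^sup>2 * (K * r) * E\<^sup>2 \<le> norm (deriv w \<zeta>)"
    and "\<exists>x. norm x \<le> K * r \<and> E \<le> norm (w x)"
proof -
  have K2: "K \<ge> 2" using K by simp
  have "norm (q * z + c) \<le> norm q * norm z + norm c"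
    by (metis norm_mult norm_triangle_ineq)
  also have "\<dots> \<le> norm q * r + r" using r z by (intro add_mono mult_left_mono) auto
  also have "\<dots> \<le> K * r" using r by (simp add: K algebra_simps)
  finally have qz: "norm (q * z + c) \<le> K * r" .
  have "1 * r \<le> K * r" using K2 r by (intro mult_right_mono) auto
  then have rK: "r \<le> K * r" by simp
  have one: "1 * 1 \<le> r * E" using r E by (intro mult_mono) auto
  have "2 * 2 \<le> K * K" using K2 by (intro mult_mono) auto
  then have KK: "3 * K\<^sup>2 \<ge> 3" by (simp add: power2_eq_square)
  have "3 * 1 * E \<le> 3 * K\<^sup>2 * r * E"
    using KK r E by (intro mult_right_mono mult_mono) auto
  then have d3: "3 * E \<le> norm (deriv w z)" using E by linarith
  then have d1: "1 \<le> norm (deriv w z)" using E by linarith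
  have "deriv w z ^ n = 1 + w z - w (q * z + c)" using eq[of z] by (simp add: algebra_simps)
  then have "norm (deriv w z) ^ n = norm (1 + w z - w (q * z + c))" by (metis norm_power)
  also have "\<dots> \<le> 1 + norm (w z) + norm (w (q * z + c))"
    using norm_triangle_ineq4[of "1 + w z" "w (q * z + c)"] norm_triangle_ineq[of 1 "w z"] by simp
  finally have up: "norm (deriv w z) ^ n \<le> 1 + norm (w z) + norm (w (q * z + c))" .
  \<comment> \<open>This is where \<open>n \<ge> 2\<close> enters: as |w'(z)| is at least 1, its
    square is below its \<open>n\<close>-th power.\<close>
  have sq: "(norm (deriv w z))\<^sup>2 \<le> 1 + norm (w z) + norm (w (q * z + c))"
    using power_increasing[OF n d1] up by linarith
  have "norm (deriv w z) \<le> 1 + norm (w z) + norm (w (q * z + c))"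
    using self_le_power[OF d1, of 2] sq by simp
  \<comment> \<open>If both values were below \<open>E\<close>, the right side would be less than 1
    + 2E, which is at most 3E.\<close>
  then have "E \<le> norm (w z) \<or> E \<le> norm (w (q * z + c))" using d3 E by linarith
  then show "\<exists>x. norm x \<le> K * r \<and> E \<le> norm (w x)" using qz z rK by (meson order_trans)

  obtain \<zeta> where \<zeta>: "norm \<zeta> \<le> K * r"
    "\<And>x. norm x \<le> K * r \<Longrightarrow> norm (deriv w x) \<le> norm (deriv w \<zeta>)"
    "\<And>x. norm x \<le> K * r \<Longrightarrow> norm (w x) \<le> norm (w 0) + K * r * norm (deriv w \<zeta>)"
    using obtain_max_deriv[OF w, of "K * r"] rK r by auto
  define m where "m = norm (deriv w \<zeta>)"
  have m1: "1 \<le> m" using \<zeta>(2)[of z] d1 z rK by (simp add: m_def)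
  \<comment> \<open>Since 1 + 2|w(0)| is at most \<open>r\<close>, hence at most
    \<open>K * r * m\<close>, it joins the two terms \<open>K * r * m\<close> coming from
    \<open>\<zeta>(3)\<close>.\<close>
  have "r * 1 \<le> K * r * m" using m1 rK r by (intro mult_mono) auto
  then have "1 + norm (w z) + norm (w (q * z + c)) \<le> 3 * (K * r * m)"
    using \<zeta>(3)[of z] \<zeta>(3)[of "q * z + c"] qz z rK r(3) by (simp add: m_def)
  moreover have "(3 * K\<^sup>2 * r * E)\<^sup>2 \<le> (norm (deriv w z))\<^sup>2"
    using E r by (intro power_mono) auto
  ultimately have "(3 * K\<^sup>2 * r * E)\<^sup>2 \<le> 3 * (K * r * m)" using sq by linarith
  \<comment> \<open>The constant \<open>3 * K\<^sup>2\<close> is chosen so that dividing the square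
    by \<open>3 * K * r\<close> reproduces the hypothesis with \<open>K * r\<close> and
    \<open>E\<^sup>2\<close> for \<open>r\<close> and \<open>E\<close>.\<close>
  then have "(3 * (K * r)) * (3 * K\<^sup>2 * (K * r) * E\<^sup>2) \<le> (3 * (K * r)) * m"
    by (simp add: power2_eq_square algebra_simps)
  then have "3 * K\<^sup>2 * (K * r) * E\<^sup>2 \<le> m"
    using K2 r by (subst (asm) mult_le_cancel_left_pos) auto
  then show "\<exists>\<zeta>. norm \<zeta> \<le> K * r \<and> 3 * K\<^sup>2 * (K * r) * E\<^sup>2 \<le> norm (deriv w \<zeta>)"
    using \<zeta>(1) unfolding m_def by blast
qed

text \<open>A derivative of at most linear growth would give \<open>w\<close> at most quadratic
  growth, making it a polynomial by Liouville.\<close>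

lemma transcendental_entire_deriv_large:
  assumes w: "transcendental_entire w"
  obtains r z where "r \<ge> A" "norm z \<le> r" "B * r \<le> norm (deriv w z)"
proof -
  define A' where "A' = Max {1, A, norm (w 0)}"
  have A': "A' \<ge> 1" "A' \<ge> A" "A' \<ge> norm (w 0)" by (auto simp: A'_def)
  have hol: "w holomorphic_on UNIV" using w by (simp add: transcendental_entire_def entire_def)
  \<comment> \<open>The extra 1 in \<open>B + 1\<close> pays for |w(0)|, which is at most |x|^2 by
    the choice of \<open>A'\<close>.\<close>
  have "\<exists>x. A' \<le> norm x \<and> norm (w x) > (B + 1) * norm x ^ 2"
  proof (rule ccontr)
    assume "\<not> ?thesis"
    then have "w \<xi> = (\<Sum>k\<le>2. (deriv ^^ k) w 0 / fact k * \<xi> ^ k)" for \<xi>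
      by (intro Liouville_polynomial[OF hol]) (auto simp: not_less)
    then have "w \<xi> = poly (\<Sum>k\<le>2. monom ((deriv ^^ k) w 0 / fact k) k) \<xi>" for \<xi>
      by (simp add: poly_sum poly_monom)
    then show False using w unfolding transcendental_entire_def by blast
  qed
  then obtain x where x: "A' \<le> norm x" "norm (w x) > (B + 1) * norm x ^ 2" by blast
  obtain \<zeta> where \<zeta>: "norm \<zeta> \<le> norm x"
    "norm (w x) \<le> norm (w 0) + norm x * norm (deriv w \<zeta>)"
    using obtain_max_deriv[OF hol norm_ge_zero[of x]] order_refl[of "norm x"] by metis
  have "norm (w 0) * 1 \<le> norm x * norm x" using x(1) A' by (intro mult_mono) auto
  then have "norm x * (B * norm x) \<le> norm x * norm (deriv w \<zeta>)"
    using x(2) \<zeta>(2) by (simp add: power2_eq_square algebra_simps)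
  then have "B * norm x \<le> norm (deriv w \<zeta>)"
    using x(1) A' by (subst (asm) mult_le_cancel_left_pos) auto
  then show ?thesis using that[of "norm x" \<zeta>] \<zeta>(1) x(1) A'(2) by linarith
qed

section \<open>Iteration along the radii \<open>K ^ j * r0\<close>\<close>

theorem theorem2p5:
  fixes m n :: nat and q c :: complex
  assumes "m > 0" and "n > 0" and "q \<noteq> 0" and "n > m" and "m = 1"
  shows "\<not> (\<exists>w. transcendental_entire w \<and> growth_order w = 0 \<and>
               (\<forall>z. deriv w z ^ n + (w (q * z + c) - w z) ^ m = 1))"
proof
  assume "\<exists>w. transcendental_entire w \<and> growth_order w = 0 \<and>
               (\<forall>z. deriv w z ^ n + (w (q * z + c) - w z) ^ m = 1)"
  then obtain w where w: "transcendental_entire w" and ord: "growth_order w = 0"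
    and eq: "\<And>z. deriv w z ^ n + (w (q * z + c) - w z) = 1"
    using \<open>m = 1\<close> by auto
  have n: "n \<ge> 2" using assms by simp
  have hol: "w holomorphic_on UNIV" using w by (simp add: transcendental_entire_def entire_def)
  define K where "K = norm q + 2"
  have K: "K > 1" using norm_ge_zero[of q] unfolding K_def by linarith
  \<comment> \<open>The factor \<open>exp 1\<close> is \<open>exp (2 ^ 0)\<close>, the start of the
    induction; the bound on \<open>r0\<close> secures all three radius conditions of the
    step.\<close>
  obtain r0 z0 where r0: "r0 \<ge> 1 + norm c + 2 * norm (w 0)" and z0: "norm z0 \<le> r0"
    "3 * K\<^sup>2 * exp 1 * r0 \<le> norm (deriv w z0)"
    using transcendental_entire_deriv_large[OF w] by blast
  define r where "r j = K ^ j * r0" for j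
  have r0': "r0 \<ge> 1" "r0 \<ge> norm c" "r0 \<ge> 1 + 2 * norm (w 0)"
    using r0 norm_ge_zero[of c] norm_ge_zero[of "w 0"] by linarith+
  have "1 * r0 \<le> r j" for j
    unfolding r_def using K r0' by (intro mult_right_mono one_le_power) auto
  then have "r0 \<le> r j" for j by simp
  then have r: "r j \<ge> 1" "r j \<ge> norm c" "r j \<ge> 1 + 2 * norm (w 0)" for j
    using r0' by (meson order_trans)+
  have r_Suc: "r (Suc j) = K * r j" for j by (simp add: r_def)
  note step = deriv_growth_step[OF hol eq n K_def r]
  have deriv_large: "\<exists>z. norm z \<le> r j \<and> 3 * K\<^sup>2 * r j * exp (2 ^ j) \<le> norm (deriv w z)" for j
  proof (induction j)
    case 0
    show ?case using z0 by (auto simp: r_def mult_ac)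
  next
    case (Suc j)
    then obtain z where "norm z \<le> r j" "3 * K\<^sup>2 * r j * exp (2 ^ j) \<le> norm (deriv w z)" by blast
    \<comment> \<open>Here \<open>E = exp (2 ^ j)\<close>, and squaring it doubles the exponent to
      \<open>2 ^ Suc j\<close>.\<close>
    from step(1)[OF this(1) _ this(2)] show ?case
      by (simp add: r_Suc exp_double)
  qed
  \<comment> \<open>Passing from \<open>w'\<close> to \<open>w\<close> enlarges the disc once more
    by \<open>K\<close>, hence the base radius \<open>K * r0\<close>.\<close>
  have "\<exists>x. norm x \<le> K * r0 * K ^ j \<and> exp (2 ^ j) \<le> norm (w x)" for j :: nat
  proof -
    obtain z where "norm z \<le> r j" "3 * K\<^sup>2 * r j * exp (2 ^ j) \<le> norm (deriv w z)"
      using deriv_large by blast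
    from step(2)[OF this(1) _ this(2)] show ?thesis by (simp add: r_def mult_ac)
  qed
  then have "growth_order w \<noteq> 0"
    using w K r0' by (intro growth_order_nonzero_if_doubly_exponential[of w K "K * r0"])
      (auto simp: transcendental_entire_def)
  then show False using ord by simp
qed

end
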